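(* Consider the $H$-stage robust linear program $$\mathrm{RO}_H := \min_{x^1} c^{1\top}x^1+\sup_{\xi^1\in\Xi^1}\Big[\min_{x^2(\xi^1)}c^{2\top}(\xi^1)x^2(\xi^1)+\sup_{\xi^2\in\Xi^2}\Big[\cdots+\sup_{\xi^{H-1}\in\Xi^{H-1}}\Big[\min_{x^H(\boldsymbol\xi^{H-1})}c^{H\top}(\boldsymbol\xi^{H-1})x^H(\boldsymbol\xi^{H-1})\Big]\Big]\Big]$$ subject to $Ax^1=h^1$, $x^1\ge 0$, and, for $t=2,\dots,H$ and all $\boldsymbol\xi^{t-1}\in\Xi^1\times\cdots\times\Xi^{t-1}$, $$T^{t-1}(\boldsymbol\xi^{t-1})x^{t-1}(\boldsymbol\xi^{t-2})+W^t(\boldsymbol\xi^{t-1})x^t(\boldsymbol\xi^{t-1})=h^t(\boldsymbol\xi^{t-1}),\qquad x^t(\boldsymbol\xi^{t-1})\ge 0 .$$ Consider also the multistage robust problem with certificates $$\mathrm{RwC}_H:=\min_{x^1,\gamma}\ \gamma$$ subject to $Ax^1=h^1$, $x^1\ge 0$, and: for all $\boldsymbol\xi^{H-1}\in\Xi$ there exist nonanticipative certificates $x^t(\boldsymbol\xi^{t-1})\in\mathbb{R}^{n_t}_+$, $t=2,\dots,H$, satisfying $$c^{1\top}x^1+c^{2\top}(\xi^1)x^2(\xi^1)+\cdots+c^{H\top}(\boldsymbol\xi^{H-1})x^H(\boldsymbol\xi^{H-1})\le\gamma$$ and $T^{t-1}(\boldsymbol\xi^{t-1})x^{t-1}(\boldsymbol\xi^{t-2})+W^t(\boldsymbol\xi^{t-1})x^t(\boldsymbol\xi^{t-1})=h^t(\boldsymbol\xi^{t-1})$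 for $t=2,\dots,H$. Then $\mathrm{RO}_H$ is equivalent to $\mathrm{RwC}_H$: the two problems have the same optimal value and the same optimal first-stage decisions $x^1$.
   Context: The uncertainty is a discrete-time random process $\xi^t$, $t=1,\dots,H-1$, with $\xi^t$ having support $\Xi^t\subseteq\mathbb{R}^{n_t}$; $\boldsymbol\xi^t:=(\xi^1,\dots,\xi^t)$ is the history up to time $t$, and $\Xi:=\Xi^1\times\cdots\times\Xi^{H-1}$. For $t=2$, $x^{t-1}(\boldsymbol\xi^{t-2})$ means $x^1$ and $\boldsymbol\xi^{t-1}=\xi^1$. The vectors $c^1\in\mathbb{R}^{n_1}$, $h^1\in\mathbb{R}^{m_1}$ and the matrix $A\in\mathbb{R}^{m_1\times n_1}$ are known; for $t=2,\dots,H$ the data $c^t(\boldsymbol\xi^{t-1})\in\mathbb{R}^{n_t}$, $h^t(\boldsymbol\xi^{t-1})\in\mathbb{R}^{m_t}$, $T^{t-1}(\boldsymbol\xi^{t-1})\in\mathbb{R}^{m_t\times n_{t-1}}$, $W^t(\boldsymbol\xi^{t-1})\in\mathbb{R}^{m_t\times n_t}$ depend on the history. Decisions are nonanticipative: $x^1$ is chosen before any uncertainty is revealed, and the decision (or certificate) $x^t(\boldsymbol\xi^{t-1})\in\mathbb{R}^{n_t}$ at stage $t=2,\dots,H$ is a function of the history $\boldsymbol\xi^{t-1}$ only. Vector inequalities are componentwise. As the notation indicates, minima are understood as attained optima; a minimum over an empty set is $+\infty$. *)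

theory Defs
  imports "Jordan_Normal_Form.Matrix" "HOL-Library.Extended_Real"
begin

text \<open>
  A history \<open>(\<xi>\<^sup>1, \<dots>, \<xi>\<^sup>k)\<close> is a list of length \<open>k\<close>. The stage-\<open>t\<close> data are functions of the
  history of length \<open>t - 1\<close>; the known vectors \<open>c\<^sup>1\<close> and \<open>h\<^sup>1\<close> are the values of \<open>cost P 1\<close> and
  \<open>rhs P 1\<close> at the empty history. \<open>techm P t\<close> is the matrix \<open>T\<^sup>t\<close>, which depends on a history of
  length \<open>t\<close> and couples stage \<open>t\<close> to stage \<open>t + 1\<close>.
\<close>

record robust_lp =
  stages :: nat
  ndim :: "nat \<Rightarrow> nat"
  mdim :: "nat \<Rightarrow> nat"
  supp :: "nat \<Rightarrow> real vec set"
  Amat :: "real mat"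
  cost :: "nat \<Rightarrow> real vec list \<Rightarrow> real vec"
  rhs :: "nat \<Rightarrow> real vec list \<Rightarrow> real vec"
  techm :: "nat \<Rightarrow> real vec list \<Rightarrow> real mat"
  recm :: "nat \<Rightarrow> real vec list \<Rightarrow> real mat"

text \<open>\<open>histories P t\<close> is \<open>\<Xi>\<^sup>1 \<times> \<dots> \<times> \<Xi>\<^sup>t\<^sup>-\<^sup>1\<close>, what is known when \<open>x\<^sup>t\<close> is chosen.\<close>

definition histories :: "robust_lp \<Rightarrow> nat \<Rightarrow> real vec list set" where
  "histories P t = listset (map (supp P) [1..<t])"

text \<open>
  The supports enter the problem only as uncertainty sets, so the process is represented by them.
  A support is never empty; this matters, since a supremum over the empty set would be \<open>-\<infinity>\<close>.
\<close>

definition well_formed :: "robust_lp \<Rightarrow> bool" where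
  "well_formed P \<longleftrightarrow>
     1 \<le> stages P \<and>
     (\<forall>t\<in>{1..<stages P}. supp P t \<noteq> {} \<and> supp P t \<subseteq> carrier_vec (ndim P t)) \<and>
     Amat P \<in> carrier_mat (mdim P 1) (ndim P 1) \<and>
     (\<forall>t\<in>{1..stages P}. \<forall>\<xi>\<in>histories P t.
        cost P t \<xi> \<in> carrier_vec (ndim P t) \<and> rhs P t \<xi> \<in> carrier_vec (mdim P t)) \<and>
     (\<forall>t\<in>{2..stages P}. \<forall>\<xi>\<in>histories P t.
        techm P (t - 1) \<xi> \<in> carrier_mat (mdim P t) (ndim P (t - 1)) \<and>
        recm P t \<xi> \<in> carrier_mat (mdim P t) (ndim P t))"

definition first_feasible :: "robust_lp \<Rightarrow> real vec set" where
  "first_feasible P =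
     {x \<in> carrier_vec (ndim P 1). 0\<^sub>v (ndim P 1) \<le> x \<and> Amat P *\<^sub>v x = rhs P 1 []}"

text \<open>Feasible \<open>x\<^sup>t\<close>, \<open>t \<ge> 2\<close>, at history \<open>\<xi>\<close> when the preceding decision is \<open>y\<close>.\<close>

definition feasible :: "robust_lp \<Rightarrow> nat \<Rightarrow> real vec list \<Rightarrow> real vec \<Rightarrow> real vec set" where
  "feasible P t \<xi> y =
     {x \<in> carrier_vec (ndim P t). 0\<^sub>v (ndim P t) \<le> x \<and>
        techm P (t - 1) \<xi> *\<^sub>v y + recm P t \<xi> *\<^sub>v x = rhs P t \<xi>}"

text \<open>
  The expression under the stage-\<open>t\<close> minimum of the nested problem, as a function of \<open>x = x\<^sup>t\<close>.
  Minima and suprema are taken in the extended reals, so that a minimum over the empty set is \<open>\<infinity>\<close>.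
\<close>

function stage_obj :: "robust_lp \<Rightarrow> nat \<Rightarrow> real vec list \<Rightarrow> real vec \<Rightarrow> ereal" where
  "stage_obj P t \<xi> x = ereal (cost P t \<xi> \<bullet> x) +
     (if t < stages P
      then SUP u\<in>supp P t. INF z\<in>feasible P (t + 1) (\<xi> @ [u]) x. stage_obj P (t + 1) (\<xi> @ [u]) z
      else 0)"
  by pat_completeness auto
termination
  by (relation "measure (\<lambda>(P, t, _, _). stages P - t)") auto

declare stage_obj.simps [simp del]

definition RO_value :: "robust_lp \<Rightarrow> ereal" where
  "RO_value P = (INF x\<in>first_feasible P. stage_obj P 1 [] x)"

text \<open>A problem with value \<open>\<infinity>\<close> counts as infeasible and has no optimal decisions.\<close>

definition RO_solutions :: "robust_lp \<Rightarrow> real vec set" where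
  "RO_solutions P =
     {x. is_arg_min (stage_obj P 1 []) (\<lambda>x. x \<in> first_feasible P) x \<and> stage_obj P 1 [] x < \<infinity>}"

text \<open>
  The stage minima for \<open>t \<ge> 2\<close> are attained, for all histories and all earlier decisions
  \<open>x\<^sup>1, \<dots>, x\<^sup>t\<^sup>-\<^sup>1\<close> that are feasible along that history. In
  particular no such minimum is \<open>-\<infinity>\<close>, since attained values are real or \<open>\<infinity>\<close>. Nothing is demanded of the first stage.
\<close>

definition minima_attained :: "robust_lp \<Rightarrow> bool" where
  "minima_attained P \<longleftrightarrow>
     (\<forall>t\<in>{2..stages P}. \<forall>\<xi>\<in>histories P t. \<forall>x :: nat \<Rightarrow> real vec.
        x 1 \<in> first_feasible P \<longrightarrow>
        (\<forall>s\<in>{2..<t}. x s \<in> feasible P s (take (s - 1) \<xi>) (x (s - 1))) \<longrightarrow>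
        feasible P t \<xi> (x (t - 1)) \<noteq> {} \<longrightarrow>
        (\<exists>z. is_arg_min (stage_obj P t \<xi>) (\<lambda>z. z \<in> feasible P t \<xi> (x (t - 1))) z))"

text \<open>
  Nonanticipativity of the certificates: they are functions of the history alone, chosen before the
  quantification over the complete realization \<open>\<xi> \<in> \<Xi>\<close>, and the stage-\<open>t\<close> certificate is applied
  only to the first \<open>t - 1\<close> components of \<open>\<xi>\<close>.
\<close>

definition RwC_feasible :: "robust_lp \<Rightarrow> real vec \<Rightarrow> real \<Rightarrow> bool" where
  "RwC_feasible P x1 \<gamma> \<longleftrightarrow>
     x1 \<in> first_feasible P \<and>
     (\<exists>x :: nat \<Rightarrow> real vec list \<Rightarrow> real vec. x 1 [] = x1 \<and>
        (\<forall>\<xi>\<in>histories P (stages P).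
           (\<forall>t\<in>{2..stages P}.
              x t (take (t - 1) \<xi>) \<in> feasible P t (take (t - 1) \<xi>) (x (t - 1) (take (t - 2) \<xi>))) \<and>
           (\<Sum>t=1..stages P. cost P t (take (t - 1) \<xi>) \<bullet> x t (take (t - 1) \<xi>)) \<le> \<gamma>))"

definition RwC_value :: "robust_lp \<Rightarrow> ereal" where
  "RwC_value P = (INF (x, \<gamma>)\<in>{(x, \<gamma>). RwC_feasible P x \<gamma>}. ereal \<gamma>)"

definition RwC_solutions :: "robust_lp \<Rightarrow> real vec set" where
  "RwC_solutions P = {x. \<exists>\<gamma>. is_arg_min snd (\<lambda>(x, \<gamma>). RwC_feasible P x \<gamma>) (x, \<gamma>)}"

end

theory Submission
  imports Defs
begin

text \<open>
  Everything follows from one equivalence: a bound \<open>\<gamma>\<close> admits nonanticipative certificates for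
  \<open>x\<^sup>1\<close> if and only if the nested objective at \<open>x\<^sup>1\<close> is at most \<open>\<gamma>\<close>. Given certificates, backward
  induction over the stages bounds the nested objective, since each inner minimum is at most the
  value at the certificate. Conversely, choosing an attained minimiser at every stage yields
  certificates, and the budget that remains after paying the first stages bounds the
  cost-to-go along every realization. Attainment also keeps the nested objective above \<open>-\<infinity>\<close>, so
  a first-stage optimum of the nested problem has a real value that can serve as \<open>\<gamma>\<close>.
\<close>

section \<open>Order facts for extended reals and minimisers\<close>

lemma ereal_add_le_ereal_iff: "ereal a + s \<le> ereal b \<longleftrightarrow> s \<le> ereal (b - a)"
  by (cases s) auto

lemma is_arg_min_INF_eq:
  fixes f :: "'a \<Rightarrow> 'b::{complete_linorder}"
  assumes "is_arg_min f (\<lambda>z. z \<in> S) z"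
  shows "(INF z\<in>S. f z) = f z"
  using assms unfolding is_arg_min_def
  by (intro antisym INF_lower INF_greatest) (auto simp: not_less)

text \<open>The reals are dense in the extended reals. For \<open>y = \<infinity>\<close> the index
  set is empty and the infimum is again \<infinity>, so a value is recovered from its real upper
  bounds even when it is infinite.\<close>

lemma INF_ereal_ge: "(INF \<gamma>\<in>{\<gamma>. y \<le> ereal \<gamma>}. ereal \<gamma>) = y"
proof (rule antisym)
  show "(INF \<gamma>\<in>{\<gamma>. y \<le> ereal \<gamma>}. ereal \<gamma>) \<le> y"
  proof (rule dense_ge)
    fix z assume "y < z"
    then obtain r where "y < ereal r" "ereal r < z"
      using ereal_dense2 by blast
    then show "(INF \<gamma>\<in>{\<gamma>. y \<le> ereal \<gamma>}. ereal \<gamma>) \<le> z"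
      by (intro INF_lower2[of r]) auto
  qed
qed (auto intro: INF_greatest)

section \<open>Histories and complete realizations\<close>

lemma mem_listset_iff: "xs \<in> listset As \<longleftrightarrow> list_all2 (\<in>) xs As"
  by (induction As arbitrary: xs) (auto simp: set_Cons_def list_all2_Cons2)

lemma histories_iff:
  "\<xi> \<in> histories P t \<longleftrightarrow> length \<xi> = t - 1 \<and> (\<forall>i<t - 1. \<xi> ! i \<in> supp P (Suc i))"
  by (auto simp: histories_def mem_listset_iff list_all2_conv_all_nth)

lemma histories_snoc:
  assumes "1 \<le> t" "\<xi> \<in> histories P t" "u \<in> supp P t"
  shows "\<xi> @ [u] \<in> histories P (Suc t)"
proof -
  have "(\<xi> @ [u]) ! i \<in> supp P (Suc i)" if "i < t" for i
  proof (cases "i < t - 1")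
    case True
    with assms(2) show ?thesis by (simp add: histories_iff nth_append)
  next
    case False
    with that have "Suc i = t" by simp
    with assms show ?thesis by (auto simp: histories_iff nth_append)
  qed
  with assms show ?thesis by (simp add: histories_iff)
qed

lemma histories_take:
  assumes "t \<le> t'" "\<xi> \<in> histories P t'"
  shows "take (t - 1) \<xi> \<in> histories P t"
  using assms by (auto simp: histories_iff)

text \<open>The uncertainty set is a product, so one component can be exchanged while the later ones
  stay admissible.\<close>

lemma histories_list_update:
  assumes "\<xi> \<in> histories P t'" "1 \<le> t" "u \<in> supp P t"
  shows "\<xi>[t - 1 := u] \<in> histories P t'"
  using assms by (cases "t - 1 < length \<xi>") (auto simp: histories_iff nth_list_update)

text \<open>Certificates are constrained only along complete realizations, so one must exist for
  these constraints to say anything.\<close>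

lemma histories_nonempty:
  assumes "well_formed P"
  shows "histories P (stages P) \<noteq> {}"
proof -
  let ?\<xi> = "map (\<lambda>i. SOME u. u \<in> supp P (Suc i)) [0..<stages P - 1]"
  have "?\<xi> \<in> histories P (stages P)"
    using assms by (auto simp: histories_iff well_formed_def some_in_eq)
  then show ?thesis by blast
qed

section \<open>The nested objective along feasible decisions\<close>

lemma stage_obj_less:
  assumes "t < stages P"
  shows "stage_obj P t \<xi> x = ereal (cost P t \<xi> \<bullet> x) +
    (SUP u\<in>supp P t. INF z\<in>feasible P (Suc t) (\<xi> @ [u]) x. stage_obj P (Suc t) (\<xi> @ [u]) z)"
  using assms by (subst stage_obj.simps) simp

lemma stage_obj_last: "stage_obj P (stages P) \<xi> x = ereal (cost P (stages P) \<xi> \<bullet> x)"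
  by (subst stage_obj.simps) simp

text \<open>Decisions along one history, indexed by the stage alone as in
  \<open>minima_attained\<close>; here the decision of stage \<open>t\<close> itself is
  included.\<close>

definition feasible_path :: "robust_lp \<Rightarrow> nat \<Rightarrow> real vec list \<Rightarrow> (nat \<Rightarrow> real vec) \<Rightarrow> bool" where
  "feasible_path P t \<xi> x \<longleftrightarrow> x 1 \<in> first_feasible P \<and>
     (\<forall>s\<in>{2..t}. x s \<in> feasible P s (take (s - 1) \<xi>) (x (s - 1)))"

lemma feasible_path_append:
  assumes "length \<xi> = t - 1"
  shows "feasible_path P t (\<xi> @ \<xi>') x \<longleftrightarrow> feasible_path P t \<xi> x"
  using assms by (auto simp: feasible_path_def)

lemma feasible_path_extend:
  assumes "1 \<le> t" "feasible_path P t \<xi> x" "length \<xi> = t"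
    and "z \<in> feasible P (Suc t) \<xi> (x t)"
  shows "feasible_path P (Suc t) \<xi> (x(Suc t := z))"
  using assms by (auto simp: feasible_path_def le_Suc_eq)

lemma stage_minimum_attained:
  assumes "minima_attained P" "1 \<le> t" "t < stages P"
    and "\<xi> \<in> histories P (Suc t)" "feasible_path P t \<xi> x"
    and "feasible P (Suc t) \<xi> (x t) \<noteq> {}"
  obtains z where
    "is_arg_min (stage_obj P (Suc t) \<xi>) (\<lambda>z. z \<in> feasible P (Suc t) \<xi> (x t)) z"
proof -
  have "Suc t \<in> {2..stages P}"
    using assms by auto
  moreover have "x 1 \<in> first_feasible P"
    "\<forall>s\<in>{2..<Suc t}. x s \<in> feasible P s (take (s - 1) \<xi>) (x (s - 1))"
    using assms by (auto simp: feasible_path_def)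
  ultimately show thesis
    using assms that unfolding minima_attained_def by (metis diff_Suc_1)
qed

text \<open>Backward induction, with \<open>x\<close> kept general because the path grows by the
  chosen minimiser. One point of the support bounds the supremum from below; its inner minimum is
  \<infinity> if infeasible and otherwise an attained value covered by the induction
  hypothesis.\<close>

lemma stage_obj_not_MInf:
  assumes "well_formed P" "minima_attained P" "1 \<le> t" "t \<le> stages P"
    and "\<xi> \<in> histories P t" "feasible_path P t \<xi> x"
  shows "stage_obj P t \<xi> (x t) \<noteq> -\<infinity>"
  using assms(4,3,5,6)
proof (induction arbitrary: \<xi> x rule: inc_induct)
  case base
  show ?case by (simp add: stage_obj_last)
next
  case (step t)
  from assms(1) step.hyps step.prems obtain u where u: "u \<in> supp P t"
    unfolding well_formed_def by (metis atLeastLessThan_iff ex_in_conv)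
  let ?\<xi> = "\<xi> @ [u]"
  have hist: "?\<xi> \<in> histories P (Suc t)"
    using step.prems u by (intro histories_snoc)
  have len: "length \<xi> = t - 1"
    using step.prems by (simp add: histories_iff)
  then have path: "feasible_path P t ?\<xi> x"
    using step.prems by (simp add: feasible_path_append)
  have "(INF z\<in>feasible P (Suc t) ?\<xi> (x t). stage_obj P (Suc t) ?\<xi> z) \<noteq> -\<infinity>"
  proof (cases "feasible P (Suc t) ?\<xi> (x t) = {}")
    case True
    then show ?thesis by (simp add: top_ereal_def)
  next
    case False
    then obtain z where z: "is_arg_min (stage_obj P (Suc t) ?\<xi>)
        (\<lambda>z. z \<in> feasible P (Suc t) ?\<xi> (x t)) z"
      using stage_minimum_attained[OF assms(2) _ _ hist path] step by auto
    then have "feasible_path P (Suc t) ?\<xi> (x(Suc t := z))"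
      using step.prems path len by (intro feasible_path_extend) (auto simp: is_arg_min_def)
    from step.IH[OF _ hist this] have "stage_obj P (Suc t) ?\<xi> z \<noteq> -\<infinity>"
      by simp
    then show ?thesis
      using is_arg_min_INF_eq[OF z] by simp
  qed
  moreover have "(INF z\<in>feasible P (Suc t) ?\<xi> (x t). stage_obj P (Suc t) ?\<xi> z) \<le>
      (SUP u\<in>supp P t. INF z\<in>feasible P (Suc t) (\<xi> @ [u]) (x t). stage_obj P (Suc t) (\<xi> @ [u]) z)"
    using u by (intro SUP_upper)
  ultimately show ?case
    using step.hyps by (auto simp: stage_obj_less)
qed

section \<open>From certificates to a bound on the nested objective\<close>

text \<open>
  The induction fixes a complete realization and replaces its \<open>t\<close>-th component, so that
  the certificate inequalities, which hold for complete realizations only, apply at every stage.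
\<close>

lemma stage_obj_le_if_certified:
  assumes "1 \<le> t" "t \<le> stages P" "\<xi> \<in> histories P (stages P)"
    and feas: "\<And>\<xi> t. \<xi> \<in> histories P (stages P) \<Longrightarrow> t \<in> {2..stages P} \<Longrightarrow>
      x t (take (t - 1) \<xi>) \<in> feasible P t (take (t - 1) \<xi>) (x (t - 1) (take (t - 2) \<xi>))"
    and cost: "\<And>\<xi>. \<xi> \<in> histories P (stages P) \<Longrightarrow>
      (\<Sum>t=1..stages P. cost P t (take (t - 1) \<xi>) \<bullet> x t (take (t - 1) \<xi>)) \<le> \<gamma>"
  shows "stage_obj P t (take (t - 1) \<xi>) (x t (take (t - 1) \<xi>)) \<le>
    ereal (\<gamma> - (\<Sum>s=1..<t. cost P s (take (s - 1) \<xi>) \<bullet> x s (take (s - 1) \<xi>)))"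
  using assms(2,1,3)
proof (induction arbitrary: \<xi> rule: inc_induct)
  case base
  then show ?case
    using cost[of \<xi>] by (simp add: stage_obj_last atLeastLessThanSuc_atLeastAtMost[symmetric])
next
  case (step t)
  let ?h = "take (t - 1) \<xi>"
  let ?S = "\<lambda>\<xi> t. \<Sum>s=1..<t. cost P s (take (s - 1) \<xi>) \<bullet> x s (take (s - 1) \<xi>)"
  have "(INF z\<in>feasible P (Suc t) (?h @ [u]) (x t ?h). stage_obj P (Suc t) (?h @ [u]) z)
      \<le> ereal (\<gamma> - ?S \<xi> (Suc t))" if u: "u \<in> supp P t" for u
  proof -
    let ?\<xi> = "\<xi>[t - 1 := u]"
    have hist: "?\<xi> \<in> histories P (stages P)"
      using step.prems u by (intro histories_list_update)
    have "t - 1 < length \<xi>"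
      using step by (simp add: histories_iff)
    then have take_t: "take t ?\<xi> = ?h @ [u]"
      using step.prems take_Suc_conv_app_nth[of "t - 1" ?\<xi>] by simp
    \<comment> \<open>The update hits position \<open>t - 1\<close>, which no prefix of length at
      most \<open>t - 1\<close> contains; the costs of stages 1 to \<open>t\<close> are
      unchanged.\<close>
    have "take (s - 1) ?\<xi> = take (s - 1) \<xi>" if "s < Suc t" for s
      using that by simp
    then have sum_eq: "?S ?\<xi> (Suc t) = ?S \<xi> (Suc t)"
      by (intro sum.cong) auto
    have "x (Suc t) (?h @ [u]) \<in> feasible P (Suc t) (?h @ [u]) (x t ?h)"
      using feas[OF hist, of "Suc t"] step.hyps step.prems take_t by simp
    then have "(INF z\<in>feasible P (Suc t) (?h @ [u]) (x t ?h). stage_obj P (Suc t) (?h @ [u]) z)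
        \<le> stage_obj P (Suc t) (?h @ [u]) (x (Suc t) (?h @ [u]))"
      by (rule INF_lower)
    also have "\<dots> \<le> ereal (\<gamma> - ?S \<xi> (Suc t))"
      using step.IH[OF _ hist] unfolding sum_eq by (simp only: diff_Suc_1 take_t)
    finally show ?thesis .
  qed
  then have "(SUP u\<in>supp P t. INF z\<in>feasible P (Suc t) (?h @ [u]) (x t ?h).
      stage_obj P (Suc t) (?h @ [u]) z) \<le> ereal (\<gamma> - ?S \<xi> (Suc t))"
    by (rule SUP_least)
  \<comment> \<open>The finite cost of stage \<open>t\<close> moves to the right, turning the budget
    left after stage \<open>t\<close> into the one left before it.\<close>
  then show ?case
    using step.hyps step.prems
    by (simp add: stage_obj_less ereal_add_le_ereal_iff algebra_simps)
qed

section \<open>From a bound to certificates\<close>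

text \<open>
  The certificate at stage \<open>Suc n\<close> has index \<open>n\<close>. The choice is junk where the stage problem
  has no minimiser.
\<close>

primrec greedy :: "robust_lp \<Rightarrow> real vec \<Rightarrow> nat \<Rightarrow> real vec list \<Rightarrow> real vec" where
  "greedy P x1 0 \<xi> = x1"
| "greedy P x1 (Suc n) \<xi> = (SOME z. is_arg_min (stage_obj P (n + 2) \<xi>)
     (\<lambda>z. z \<in> feasible P (n + 2) \<xi> (greedy P x1 n (take n \<xi>))) z)"

text \<open>Forward induction: the supremum bounds the minimum at the realized component by the
  remaining budget, and the greedy choice attains this minimum.\<close>

lemma greedy_feasible_bound:
  assumes "minima_attained P" "x1 \<in> first_feasible P" "stage_obj P 1 [] x1 \<le> ereal \<gamma>"
    and "\<xi> \<in> histories P (stages P)" "1 \<le> t" "t \<le> stages P"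
  defines "x \<equiv> \<lambda>t. greedy P x1 (t - 1) (take (t - 1) \<xi>)"
  shows "feasible_path P t \<xi> x \<and>
    stage_obj P t (take (t - 1) \<xi>) (x t) \<le>
      ereal (\<gamma> - (\<Sum>s=1..<t. cost P s (take (s - 1) \<xi>) \<bullet> x s))"
  using assms(5,6)
proof (induction rule: dec_induct)
  case base
  then show ?case
    using assms(2,3) by (auto simp: x_def feasible_path_def)
next
  case (step t)
  let ?h = "take (t - 1) \<xi>" and ?h' = "take t \<xi>" and ?u = "\<xi> ! (t - 1)"
  let ?F = "feasible P (Suc t) ?h' (x t)"
  let ?S = "\<lambda>t. \<Sum>s=1..<t. cost P s (take (s - 1) \<xi>) \<bullet> x s"
  have IH: "feasible_path P t \<xi> x" "stage_obj P t ?h (x t) \<le> ereal (\<gamma> - ?S t)"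
    using step by auto
  have "t - 1 < length \<xi>" and u: "?u \<in> supp P t"
    using assms(4) step by (auto simp: histories_iff dest!: spec[of _ "t - 1"])
  then have h': "?h' = ?h @ [?u]"
    using step.hyps take_Suc_conv_app_nth[of "t - 1" \<xi>] by simp
  have hist: "?h' \<in> histories P (Suc t)"
    using histories_take[OF _ assms(4), of "Suc t"] step.prems by simp
  have len: "length ?h' = t"
    using hist by (simp add: histories_iff)
  have path: "feasible_path P t ?h' x"
    using IH(1) by (auto simp: feasible_path_def)
  have "(SUP u\<in>supp P t. INF z\<in>feasible P (Suc t) (?h @ [u]) (x t).
      stage_obj P (Suc t) (?h @ [u]) z) \<le> ereal (\<gamma> - ?S (Suc t))"
    using IH(2) step by (simp add: stage_obj_less ereal_add_le_ereal_iff algebra_simps)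
  then have inf_le: "(INF z\<in>?F. stage_obj P (Suc t) ?h' z) \<le> ereal (\<gamma> - ?S (Suc t))"
    unfolding h' using u by (meson SUP_upper order_trans)
  \<comment> \<open>A minimum over the empty set would be \<infinity>, which no real budget
    bounds.\<close>
  then have "?F \<noteq> {}"
    by (auto simp: top_ereal_def)
  then obtain z where z: "is_arg_min (stage_obj P (Suc t) ?h') (\<lambda>z. z \<in> ?F) z"
    using stage_minimum_attained[OF assms(1) _ _ hist path] step by auto
  \<comment> \<open>The nested truncation of \<open>take t \<xi>\<close> collapses to
    \<open>take (t - 1) \<xi>\<close>, so the preceding greedy choice is \<open>x t\<close>.\<close>
  have "x (Suc t) = (SOME z. is_arg_min (stage_obj P (Suc t) ?h') (\<lambda>z. z \<in> ?F) z)"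
    using step.hyps by (cases t) (auto simp: x_def min_def)
  then have arg_min: "is_arg_min (stage_obj P (Suc t) ?h') (\<lambda>z. z \<in> ?F) (x (Suc t))"
    using someI[of "is_arg_min (stage_obj P (Suc t) ?h') (\<lambda>z. z \<in> ?F)", OF z] by simp
  then have "feasible_path P (Suc t) \<xi> x"
    using IH(1) by (auto simp: feasible_path_def is_arg_min_def le_Suc_eq)
  moreover have "stage_obj P (Suc t) ?h' (x (Suc t)) \<le> ereal (\<gamma> - ?S (Suc t))"
    using inf_le is_arg_min_INF_eq[OF arg_min] by simp
  ultimately show ?case by simp
qed

section \<open>Equivalence of the two problems\<close>

text \<open>The certificate problem minimises \<gamma> over the epigraph of the nested first-stage
  objective.\<close>

lemma RwC_feasible_iff:
  assumes "well_formed P" "minima_attained P"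
  shows "RwC_feasible P x1 \<gamma> \<longleftrightarrow> x1 \<in> first_feasible P \<and> stage_obj P 1 [] x1 \<le> ereal \<gamma>"
proof (intro iffI conjI)
  assume R: "RwC_feasible P x1 \<gamma>"
  then show "x1 \<in> first_feasible P"
    by (simp add: RwC_feasible_def)
  obtain \<xi> where \<xi>: "\<xi> \<in> histories P (stages P)"
    using histories_nonempty[OF assms(1)] by blast
  have "1 \<le> stages P"
    using assms(1) by (simp add: well_formed_def)
  moreover obtain x where x1: "x 1 [] = x1" and cert: "\<forall>\<xi>\<in>histories P (stages P).
      (\<forall>t\<in>{2..stages P}.
        x t (take (t - 1) \<xi>) \<in> feasible P t (take (t - 1) \<xi>) (x (t - 1) (take (t - 2) \<xi>))) \<and>
      (\<Sum>t=1..stages P. cost P t (take (t - 1) \<xi>) \<bullet> x t (take (t - 1) \<xi>)) \<le> \<gamma>"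
    using R unfolding RwC_feasible_def by blast
  \<comment> \<open>At stage 1 the prefix and the sum of earlier costs are empty, so any realization
    serves.\<close>
  ultimately have "stage_obj P 1 (take (1 - 1) \<xi>) (x 1 (take (1 - 1) \<xi>)) \<le>
      ereal (\<gamma> - (\<Sum>s=1..<1. cost P s (take (s - 1) \<xi>) \<bullet> x s (take (s - 1) \<xi>)))"
    using \<xi> by (intro stage_obj_le_if_certified) blast+
  with x1 show "stage_obj P 1 [] x1 \<le> ereal \<gamma>"
    by simp
next
  assume A: "x1 \<in> first_feasible P \<and> stage_obj P 1 [] x1 \<le> ereal \<gamma>"
  \<comment> \<open>Chosen before any realization is fixed, hence nonanticipative.\<close>
  define x where "x t = greedy P x1 (t - 1)" for t
  have "(\<forall>t\<in>{2..stages P}.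
        x t (take (t - 1) \<xi>) \<in> feasible P t (take (t - 1) \<xi>) (x (t - 1) (take (t - 2) \<xi>))) \<and>
      (\<Sum>t=1..stages P. cost P t (take (t - 1) \<xi>) \<bullet> x t (take (t - 1) \<xi>)) \<le> \<gamma>"
    if "\<xi> \<in> histories P (stages P)" for \<xi>
  proof -
    have H: "1 \<le> stages P"
      using assms(1) by (simp add: well_formed_def)
    have cert: "feasible_path P (stages P) \<xi> (\<lambda>t. x t (take (t - 1) \<xi>))"
      "stage_obj P (stages P) (take (stages P - 1) \<xi>) (x (stages P) (take (stages P - 1) \<xi>)) \<le>
        ereal (\<gamma> - (\<Sum>s=1..<stages P. cost P s (take (s - 1) \<xi>) \<bullet> x s (take (s - 1) \<xi>)))"
      using greedy_feasible_bound[OF assms(2) _ _ that H order_refl] A by (auto simp: x_def)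
    show ?thesis
    proof
      have "t - 1 - 1 = t - 2" for t :: nat by simp
      with cert(1) show "\<forall>t\<in>{2..stages P}.
        x t (take (t - 1) \<xi>) \<in> feasible P t (take (t - 1) \<xi>) (x (t - 1) (take (t - 2) \<xi>))"
        unfolding feasible_path_def by metis
      \<comment> \<open>The last nested objective is just the last cost, so the remaining budget
        bounds the total.\<close>
      show "(\<Sum>t=1..stages P. cost P t (take (t - 1) \<xi>) \<bullet> x t (take (t - 1) \<xi>)) \<le> \<gamma>"
        using cert(2) H
        by (simp add: stage_obj_last atLeastLessThanSuc_atLeastAtMost[symmetric])
    qed
  qed
  moreover have "x 1 [] = x1"
    by (simp add: x_def)
  ultimately show "RwC_feasible P x1 \<gamma>"
    unfolding RwC_feasible_def using A by blast
qed

theorem theorem3: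
  fixes P :: robust_lp
  assumes "well_formed P"
    and "minima_attained P"
  shows "RO_value P = RwC_value P \<and> RO_solutions P = RwC_solutions P"
proof
  let ?f = "stage_obj P 1 []" and ?X = "first_feasible P"
  note feas = RwC_feasible_iff[OF assms]
  show "RO_value P = RwC_value P"
  proof (rule antisym)
    show "RO_value P \<le> RwC_value P"
      unfolding RO_value_def RwC_value_def
    proof (rule INF_greatest, clarify)
      fix x \<gamma> assume "RwC_feasible P x \<gamma>"
      then show "(INF x\<in>?X. ?f x) \<le> ereal \<gamma>"
        by (intro INF_lower2[of x]) (simp_all add: feas)
    qed
    show "RwC_value P \<le> RO_value P"
      unfolding RO_value_def
    proof (rule INF_greatest)
      fix x assume "x \<in> ?X"
      then have "RwC_value P \<le> ereal \<gamma>" if "?f x \<le> ereal \<gamma>" for \<gamma>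
        unfolding RwC_value_def using that by (intro INF_lower2[of "(x, \<gamma>)"]) (auto simp: feas)
      then have "RwC_value P \<le> (INF \<gamma>\<in>{\<gamma>. ?f x \<le> ereal \<gamma>}. ereal \<gamma>)"
        by (intro INF_greatest) simp
      then show "RwC_value P \<le> ?f x"
        by (simp only: INF_ereal_ge)
    qed
  qed
  \<comment> \<open>A path of length one constrains only its first entry, so a constant function
    serves.\<close>
  have not_MInf: "?f x \<noteq> -\<infinity>" if "x \<in> ?X" for x
    using stage_obj_not_MInf[OF assms, of 1 "[]" "\<lambda>_. x"] that assms(1)
    by (simp add: well_formed_def histories_iff feasible_path_def)
  show "RO_solutions P = RwC_solutions P"
  proof (intro equalityI subsetI)
    fix x assume "x \<in> RO_solutions P"
    then have x: "x \<in> ?X" "\<And>y. y \<in> ?X \<Longrightarrow> ?f x \<le> ?f y" "?f x < \<infinity>"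
      by (auto simp: RO_solutions_def is_arg_min_def not_less)
    \<comment> \<open>The optimal value is real, hence itself an admissible \<gamma>.\<close>
    with not_MInf obtain r where r: "?f x = ereal r"
      by (cases "?f x") auto
    have "r \<le> \<delta>" if "y \<in> ?X" "?f y \<le> ereal \<delta>" for y \<delta>
      using order_trans[OF x(2) that(2)] that(1) r by simp
    then have "is_arg_min snd (\<lambda>(x, \<gamma>). RwC_feasible P x \<gamma>) (x, r)"
      using x(1) r by (auto simp: is_arg_min_def feas not_less)
    then show "x \<in> RwC_solutions P"
      by (auto simp: RwC_solutions_def)
  next
    fix x assume "x \<in> RwC_solutions P"
    then obtain \<gamma> where x: "x \<in> ?X" "?f x \<le> ereal \<gamma>"
      and min: "\<And>y \<delta>. y \<in> ?X \<Longrightarrow> ?f y \<le> ereal \<delta> \<Longrightarrow> \<gamma> \<le> \<delta>"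
      by (auto simp: RwC_solutions_def is_arg_min_def feas not_less)
    have "?f x \<le> ?f y" if "y \<in> ?X" for y
    proof -
      \<comment> \<open>If the objective at \<open>y\<close> is real, it serves as \<delta>; if it
        is \<infinity>, the bound is trivial.\<close>
      have "ereal \<gamma> \<le> ?f y"
        using min[OF that] not_MInf[OF that] by (cases "?f y") auto
      with x show ?thesis by simp
    qed
    with x show "x \<in> RO_solutions P"
      by (auto simp: RO_solutions_def is_arg_min_def not_less)
  qed
qed

end
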